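(* Let $(X_1,d_1,\nu_1)$ and $(X_2,d_2,\nu_2)$ be two measured length spaces and let $K\in\mathbb{R}$. Suppose that both spaces satisfy $PL(K)$. Then the product space $(X_1\times X_2,d_{X_1\times X_2},\nu_1\otimes\nu_2)$, where $d_{X_1\times X_2}$ is the Euclidean product distance, also satisfies $PL(K)$.
   Context: A length space is a metric space $(X,d)$ in which the distance between two points is the infimum of the lengths of curves joining them. A measured length space $(X,d,\nu)$ is a length space with a Borel probability measure $\nu$. The Euclidean product distance on $X_1\times X_2$ is defined by $$d_{X_1\times X_2}((x_1,x_2),(y_1,y_2))^2:=d_1(x_1,y_1)^2+d_2(x_2,y_2)^2.$$ For $x,y\in X$ and $t\in[0,1]$, $Z_t(x,y)$ is the set of $z\in X$ with $d(x,z)=t\,d(x,y)$ and $d(z,y)=(1-t)\,d(x,y)$. $(X,d,\nu)$ satisfies the Prékopa-Leindler inequality $PL(K)$, $K\in\mathbb{R}$, if for every $t\in[0,1]$ and every triple of functions $u,v,w\in L^1(X,\mathbb{R}_+^* )$ (strictly positive, $\nu$-integrable) satisfying $$u(x)^{1-t}v(y)^t\exp\left(-K\frac{t(1-t)}{2}d(x,y)^2\right)\leq w(z)\quad\text{for all }x,y\in X,\ z\in Z_t(x,y),$$ one has $$\left(\int_X u\,d\nu\right)^{1-t}\left(\int_X v\,d\nu\right)^t\leq\int_X w\,d\nu.$$ *)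

theory Defs
  imports "HOL-Probability.Probability"
begin

(* Supremum of the inscribed polygonal sums; infinite for non-rectifiable curves. *)
definition curve_length :: "(real \<Rightarrow> 'a::metric_space) \<Rightarrow> ennreal" where
  "curve_length g =
     (SUP ts \<in> {ts. sorted ts \<and> set ts \<subseteq> {0..1}}.
        \<Sum>i<length ts - 1. ennreal (dist (g (ts ! i)) (g (ts ! Suc i))))"

(* In ennreal the infimum over no curves is infinite, so any two points are joined by
   a rectifiable curve. *)
locale measured_length_space = prob_space M for M :: "'a::metric_space measure" +
  assumes sets_eq_borel: "sets M = sets borel"
    and dist_eq_inf_length: "\<And>x y :: 'a.
      ennreal (dist x y) =
         (INF g \<in> {g. path g \<and> pathstart g = x \<and> pathfinish g = y}. curve_length g)"

definition intermediate_points :: "real \<Rightarrow> 'a::metric_space \<Rightarrow> 'a \<Rightarrow> 'a set" where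
  "intermediate_points t x y = {z. dist x z = t * dist x y \<and> dist z y = (1 - t) * dist x y}"

(* M is not required to be a Borel measure: without second countability, the product of
   two Borel sigma-algebras can be smaller than the Borel sigma-algebra of the product. *)
definition prekopa_leindler :: "real \<Rightarrow> 'a::metric_space measure \<Rightarrow> bool" where
  "prekopa_leindler K M \<longleftrightarrow>
     (\<forall>t\<in>{0..1}. \<forall>u v w :: 'a \<Rightarrow> real.
        integrable M u \<and> integrable M v \<and> integrable M w \<and>
        (\<forall>x. u x > 0) \<and> (\<forall>x. v x > 0) \<and> (\<forall>x. w x > 0) \<and>
        (\<forall>x y. \<forall>z\<in>intermediate_points t x y.
           u x powr (1 - t) * v y powr t * exp (- K * (t * (1 - t) / 2) * (dist x y)\<^sup>2) \<le> w z)
        \<longrightarrow> (\<integral>x. u x \<partial>M) powr (1 - t) * (\<integral>x. v x \<partial>M) powr t \<le> (\<integral>x. w x \<partial>M))"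

end

theory Submission
  imports Defs
begin

text \<open>
  The inequality tensorises through partial integration. Let \<open>U\<close>, \<open>V\<close>, \<open>W\<close> be the functions of the
  second coordinate that arise from \<open>u\<close>, \<open>v\<close>, \<open>w\<close> by integrating out the first one. Pairs of
  intermediate points are intermediate points of pairs, and the squared product distance is the sum
  of the squared distances, so the Gaussian factor splits into a product. For fixed second
  coordinates \<open>x\<^sub>2\<close>, \<open>y\<^sub>2\<close>, \<open>z\<^sub>2\<close>, the inequality on the first factor therefore turns the hypothesis
  on \<open>u\<close>, \<open>v\<close>, \<open>w\<close> into the same hypothesis on \<open>U\<close>, \<open>V\<close>, \<open>W\<close>; the inequality on the second factor
  and Fubini's theorem conclude (\<open>prekopa_leindler_pair_sections\<close>).

  The point that needs care is that the hypothesis of the inequality is pointwise, whereas Fubini's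
  theorem gives integrability of the sections only almost everywhere. So \<open>w\<close> is first replaced by
  \<open>min w c\<close>, whose sections are all integrable. When \<open>K < 0\<close> the Gaussian factor may be unbounded, and
  cutting \<open>u\<close> and \<open>v\<close> at a constant need not keep the left-hand side of the hypothesis below
  \<open>c\<close>. They are instead cut at the decaying height \<open>c * exp (-\<bar>K\<bar> * d(x, x\<^sub>0)\<^sup>2)\<close>, which outweighs the
  Gaussian factor for either sign of \<open>K\<close> (\<open>gaussian_factor_le\<close>). Letting \<open>c\<close> tend to infinity
  recovers the inequality for \<open>u\<close>, \<open>v\<close>, \<open>w\<close>, by dominated convergence.
\<close>

section \<open>Intermediate points and the Gaussian factor\<close>

lemma dist_Pair_power2:
  "(dist x y)\<^sup>2 = (dist (fst x) (fst y))\<^sup>2 + (dist (snd x) (snd y))\<^sup>2"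
  by (simp add: dist_prod_def)

lemma intermediate_points_Pair:
  assumes t: "t \<in> {0..1}"
    and "z1 \<in> intermediate_points t x1 y1" and "z2 \<in> intermediate_points t x2 y2"
  shows "(z1, z2) \<in> intermediate_points t (x1, x2) (y1, y2)"
proof -
  have scale: "sqrt ((s * a)\<^sup>2 + (s * b)\<^sup>2) = s * sqrt (a\<^sup>2 + b\<^sup>2)" if "s \<ge> 0" for s a b :: real
    using that by (simp add: power_mult_distrib real_sqrt_mult flip: distrib_left)
  show ?thesis
    using assms scale[of t] scale[of "1 - t"]
    by (simp add: intermediate_points_def dist_Pair_Pair)
qed

text \<open>
  The hypothesis sees \<open>exp (-\<bar>K\<bar> * d(x, x\<^sub>0)\<^sup>2)\<close> to the power \<open>1 - t\<close> and \<open>exp (-\<bar>K\<bar> * d(y, x\<^sub>0)\<^sup>2)\<close> to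
  the power \<open>t\<close>. Since \<open>d(x, y)\<^sup>2 \<le> 2 * (d(x, x\<^sub>0)\<^sup>2 + d(y, x\<^sub>0)\<^sup>2)\<close> and \<open>t * (1 - t)\<close> is at most both
  \<open>t\<close> and \<open>1 - t\<close>, these weights absorb the Gaussian factor.
\<close>

lemma gaussian_factor_le:
  fixes x y a :: "'a::metric_space" and K t :: real
  assumes t: "t \<in> {0..1}"
  shows "- K * (t * (1 - t) / 2) * (dist x y)\<^sup>2
           \<le> \<bar>K\<bar> * ((1 - t) * (dist x a)\<^sup>2 + t * (dist y a)\<^sup>2)"
proof -
  have "(dist x y)\<^sup>2 \<le> (dist x a + dist y a)\<^sup>2"
    by (intro power_mono dist_triangle2) auto
  also have "\<dots> \<le> 2 * ((dist x a)\<^sup>2 + (dist y a)\<^sup>2)"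
    using sum_squares_bound[of "dist x a" "dist y a"] by (simp add: power2_sum)
  finally have d: "(dist x y)\<^sup>2 / 2 \<le> (dist x a)\<^sup>2 + (dist y a)\<^sup>2"
    by simp
  have "- K * (t * (1 - t) / 2) * (dist x y)\<^sup>2 = - K * (t * (1 - t) * ((dist x y)\<^sup>2 / 2))"
    by simp
  also have "\<dots> \<le> \<bar>K\<bar> * (t * (1 - t) * ((dist x y)\<^sup>2 / 2))"
    using t by (intro mult_right_mono) auto
  also have "\<dots> \<le> \<bar>K\<bar> * (t * (1 - t) * ((dist x a)\<^sup>2 + (dist y a)\<^sup>2))"
    using t d by (intro mult_left_mono) auto
  also have "t * (1 - t) * ((dist x a)\<^sup>2 + (dist y a)\<^sup>2)
               \<le> (1 - t) * (dist x a)\<^sup>2 + t * (dist y a)\<^sup>2"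
    using t mult_right_mono[of "t * (1 - t)" "1 - t" "(dist x a)\<^sup>2"]
      mult_right_mono[of "t * (1 - t)" t "(dist y a)\<^sup>2"]
    by (simp add: distrib_left mult_left_le mult_left_le_one_le)
  finally show ?thesis
    by (simp add: mult_left_mono)
qed

lemma powr_weights_exp_le:
  fixes p q c K t :: real
  assumes t: "t \<in> {0..1}" and c: "c > 0" and "p > 0" "q > 0"
    and p: "p \<le> c * exp (- \<bar>K\<bar> * (dist x a)\<^sup>2)" and q: "q \<le> c * exp (- \<bar>K\<bar> * (dist y a)\<^sup>2)"
  shows "p powr (1 - t) * q powr t * exp (- K * (t * (1 - t) / 2) * (dist x y)\<^sup>2) \<le> c"
proof -
  let ?A = "(dist x a)\<^sup>2" and ?B = "(dist y a)\<^sup>2"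
  let ?E = "\<bar>K\<bar> * ((1 - t) * ?A + t * ?B)"
  have "p powr (1 - t) * q powr t
      \<le> (c * exp (- \<bar>K\<bar> * ?A)) powr (1 - t) * (c * exp (- \<bar>K\<bar> * ?B)) powr t"
    using assms by (intro mult_mono powr_mono2) auto
  also have "\<dots> = (c powr (1 - t) * c powr t)
      * (exp (- \<bar>K\<bar> * ?A * (1 - t)) * exp (- \<bar>K\<bar> * ?B * t))"
    using c by (simp add: powr_mult exp_powr_real mult_ac)
  also have "c powr (1 - t) * c powr t = c"
    using c by (simp flip: powr_add)
  also have "exp (- \<bar>K\<bar> * ?A * (1 - t)) * exp (- \<bar>K\<bar> * ?B * t) = exp (- ?E)"
    by (subst exp_add[symmetric]) (simp add: algebra_simps)
  finally have "p powr (1 - t) * q powr t \<le> c * exp (- ?E)" .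
  moreover have "exp (- K * (t * (1 - t) / 2) * (dist x y)\<^sup>2) \<le> exp ?E"
    using gaussian_factor_le[OF t, of K x y a] by (simp only: exp_le_cancel_iff)
  ultimately have "p powr (1 - t) * q powr t * exp (- K * (t * (1 - t) / 2) * (dist x y)\<^sup>2)
      \<le> c * exp (- ?E) * exp ?E"
    by (rule mult_mono) (use c in simp_all)
  also have "\<dots> = c"
    by (simp add: mult.assoc flip: exp_add)
  finally show ?thesis .
qed

section \<open>Tensorisation\<close>

lemma (in prob_space) integral_pos:
  fixes f :: "'a \<Rightarrow> real"
  assumes "integrable M f" and "\<And>x. f x > 0"
  shows "(\<integral>x. f x \<partial>M) > 0"
  using integral_less_AE_space[of "\<lambda>_. 0" f] assms emeasure_space_1 by simp

lemma prekopa_leindlerD: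
  assumes "prekopa_leindler K M" and "t \<in> {0..1}"
    and "integrable M u" "integrable M v" "integrable M w"
    and "\<And>x. u x > 0" "\<And>x. v x > 0" "\<And>x. w x > 0"
    and "\<And>x y z. z \<in> intermediate_points t x y \<Longrightarrow>
           u x powr (1 - t) * v y powr t * exp (- K * (t * (1 - t) / 2) * (dist x y)\<^sup>2) \<le> w z"
  shows "(\<integral>x. u x \<partial>M) powr (1 - t) * (\<integral>x. v x \<partial>M) powr t \<le> (\<integral>x. w x \<partial>M)"
  using assms(2-)
  by (intro assms(1)[unfolded prekopa_leindler_def, rule_format, of t u v w] conjI allI ballI)

lemma prekopa_leindler_pair_sections:
  fixes M1 :: "'a::metric_space measure" and M2 :: "'b::metric_space measure"
    and u v w :: "'a \<times> 'b \<Rightarrow> real"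
  assumes "prob_space M1" and "prob_space M2"
    and PL1: "prekopa_leindler K M1" and PL2: "prekopa_leindler K M2"
    and t: "t \<in> {0..1}"
    and int: "integrable (M1 \<Otimes>\<^sub>M M2) u" "integrable (M1 \<Otimes>\<^sub>M M2) v" "integrable (M1 \<Otimes>\<^sub>M M2) w"
    and sec: "\<And>b. integrable M1 (\<lambda>a. u (a, b))" "\<And>b. integrable M1 (\<lambda>a. v (a, b))"
      "\<And>b. integrable M1 (\<lambda>a. w (a, b))"
    and pos: "\<And>x. u x > 0" "\<And>x. v x > 0" "\<And>x. w x > 0"
    and uvw: "\<And>x y z. z \<in> intermediate_points t x y \<Longrightarrow>
      u x powr (1 - t) * v y powr t * exp (- K * (t * (1 - t) / 2) * (dist x y)\<^sup>2) \<le> w z"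
  shows "(\<integral>x. u x \<partial>(M1 \<Otimes>\<^sub>M M2)) powr (1 - t) * (\<integral>x. v x \<partial>(M1 \<Otimes>\<^sub>M M2)) powr t
           \<le> (\<integral>x. w x \<partial>(M1 \<Otimes>\<^sub>M M2))"
proof -
  interpret M1: prob_space M1 by fact
  interpret M2: prob_space M2 by fact
  interpret pair_prob_space M1 M2 ..
  define U where "U = (\<lambda>b. \<integral>a. u (a, b) \<partial>M1)"
  define V where "V = (\<lambda>b. \<integral>a. v (a, b) \<partial>M1)"
  define W where "W = (\<lambda>b. \<integral>a. w (a, b) \<partial>M1)"
  have "(\<integral>b. U b \<partial>M2) powr (1 - t) * (\<integral>b. V b \<partial>M2) powr t \<le> (\<integral>b. W b \<partial>M2)"
  proof (rule prekopa_leindlerD[OF PL2 t])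
    show "integrable M2 U" "integrable M2 V" "integrable M2 W"
      using integrable_snd[of "\<lambda>a b. u (a, b)"] integrable_snd[of "\<lambda>a b. v (a, b)"]
        integrable_snd[of "\<lambda>a b. w (a, b)"] int
      by (simp_all add: U_def V_def W_def)
    show "U b > 0" "V b > 0" "W b > 0" for b
      unfolding U_def V_def W_def by (intro M1.integral_pos sec pos)+
  next
    fix x2 y2 z2 :: 'b assume z2: "z2 \<in> intermediate_points t x2 y2"
    define e where "e = exp (- K * (t * (1 - t) / 2) * (dist x2 y2)\<^sup>2)"
    have e: "e > 0" by (simp add: e_def)
    \<comment> \<open>The factor \<open>e\<close> is moved to \<open>w\<close>, on which the inequality depends linearly; on \<open>u\<close> or \<open>v\<close> it
      would need a root of order \<open>1 - t\<close> or \<open>t\<close>, and both may vanish.\<close>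
    have "U x2 powr (1 - t) * V y2 powr t \<le> (\<integral>a. w (a, z2) / e \<partial>M1)"
      unfolding U_def V_def
    proof (rule prekopa_leindlerD[OF PL1 t])
      fix x1 y1 z1 :: 'a assume z1: "z1 \<in> intermediate_points t x1 y1"
      have "u (x1, x2) powr (1 - t) * v (y1, y2) powr t
            * exp (- K * (t * (1 - t) / 2) * (dist (x1, x2) (y1, y2))\<^sup>2) \<le> w (z1, z2)"
        by (rule uvw[OF intermediate_points_Pair[OF t z1 z2]])
      also have "exp (- K * (t * (1 - t) / 2) * (dist (x1, x2) (y1, y2))\<^sup>2)
          = exp (- K * (t * (1 - t) / 2) * (dist x1 y1)\<^sup>2) * e"
        by (simp only: e_def dist_Pair_power2 distrib_left exp_add fst_conv snd_conv)
      finally show "u (x1, x2) powr (1 - t) * v (y1, y2) powr t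
            * exp (- K * (t * (1 - t) / 2) * (dist x1 y1)\<^sup>2) \<le> w (z1, z2) / e"
        using e by (simp add: pos_le_divide_eq mult.assoc)
    next
      show "integrable M1 (\<lambda>a. w (a, z2) / e)"
        by (intro integrable_divide sec)
      show "w (a, z2) / e > 0" for a
        by (intro divide_pos_pos pos e)
    qed (intro sec pos)+
    then show "U x2 powr (1 - t) * V y2 powr t
        * exp (- K * (t * (1 - t) / 2) * (dist x2 y2)\<^sup>2) \<le> W z2"
      unfolding e_def[symmetric] using e by (simp add: W_def pos_le_divide_eq)
  qed
  then show ?thesis
    using integral_snd[of "\<lambda>a b. u (a, b)"] integral_snd[of "\<lambda>a b. v (a, b)"]
      integral_snd[of "\<lambda>a b. w (a, b)"] int
    by (simp add: U_def V_def W_def)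
qed

section \<open>Removal of the truncation\<close>

lemma integral_min_mult_tendsto:
  fixes u g :: "'a \<Rightarrow> real"
  assumes u: "integrable M u" and [measurable]: "g \<in> borel_measurable M"
    and u0: "\<And>x. u x > 0" and g0: "\<And>x. g x > 0"
  shows "(\<lambda>n. \<integral>x. min (u x) (real (Suc n) * g x) \<partial>M) \<longlonglongrightarrow> (\<integral>x. u x \<partial>M)"
proof (rule integral_dominated_convergence[where w = u])
  have [measurable]: "u \<in> borel_measurable M" using u by auto
  show "u \<in> borel_measurable M" "(\<lambda>x. min (u x) (real (Suc n) * g x)) \<in> borel_measurable M" for n
    by measurable
  have "(\<lambda>n. min (u x) (real (Suc n) * g x)) \<longlonglongrightarrow> u x" for x
  proof (rule tendsto_eventually)
    obtain N :: nat where N: "u x / g x \<le> real N"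
      using real_arch_simple by blast
    have "min (u x) (real (Suc n) * g x) = u x" if "n \<ge> N" for n
    proof -
      have "u x / g x \<le> real (Suc n)" using N that by linarith
      then show ?thesis using g0[of x] by (simp add: pos_divide_le_eq)
    qed
    then show "\<forall>\<^sub>F n in sequentially. min (u x) (real (Suc n) * g x) = u x"
      by (auto simp: eventually_sequentially)
  qed
  then show "AE x in M. (\<lambda>n. min (u x) (real (Suc n) * g x)) \<longlonglongrightarrow> u x" by simp
  show "AE x in M. norm (min (u x) (real (Suc n) * g x)) \<le> u x" for n
  proof (rule AE_I2)
    fix x
    have "0 < real (Suc n) * g x" using g0[of x] by simp
    then show "norm (min (u x) (real (Suc n) * g x)) \<le> u x"
      using u0[of x] by (simp add: min_def)
  qed
qed (use u in auto)

theorem theorem2p5: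
  fixes M1 :: "'a::metric_space measure" and M2 :: "'b::metric_space measure" and K :: real
  assumes "measured_length_space M1" and "measured_length_space M2"
    and "prekopa_leindler K M1" and "prekopa_leindler K M2"
  shows "prekopa_leindler K (M1 \<Otimes>\<^sub>M M2)"
proof -
  interpret M1: measured_length_space M1 by fact
  interpret M2: measured_length_space M2 by fact
  interpret pair_prob_space M1 M2 ..
  have [measurable_cong]: "sets M1 = sets borel" "sets M2 = sets borel"
    by (fact M1.sets_eq_borel, fact M2.sets_eq_borel)
  have space: "space M1 = UNIV" "space M2 = UNIV"
    using sets_eq_imp_space_eq[OF M1.sets_eq_borel] sets_eq_imp_space_eq[OF M2.sets_eq_borel]
    by simp_all
  let ?M = "M1 \<Otimes>\<^sub>M M2"
  fix o1 :: 'a and o2 :: 'b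
  define g where "g x = exp (- \<bar>K\<bar> * (dist x (o1, o2))\<^sup>2)" for x :: "'a \<times> 'b"
  have g0: "g x > 0" and g1: "g x \<le> 1" for x
    by (simp_all add: g_def)
  \<comment> \<open>The product distance is measurable because its square is a sum of functions of one coordinate;
    continuity would not suffice, as the product of the Borel algebras may be too small.\<close>
  have [measurable]: "(\<lambda>a. dist a o1) \<in> borel_measurable M1" "(\<lambda>b. dist b o2) \<in> borel_measurable M2"
    by (auto simp: measurable_cong_sets[OF M1.sets_eq_borel refl]
        measurable_cong_sets[OF M2.sets_eq_borel refl]
        intro!: borel_measurable_continuous_onI continuous_intros)
  have [measurable]: "(\<lambda>x. dist (fst x) o1) \<in> borel_measurable ?M"
    by (rule measurable_compose[OF measurable_fst]) fact
  have [measurable]: "(\<lambda>x. dist (snd x) o2) \<in> borel_measurable ?M"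
    by (rule measurable_compose[OF measurable_snd]) fact
  have g [measurable]: "g \<in> borel_measurable ?M"
    unfolding g_def dist_Pair_power2 fst_conv snd_conv by measurable
  have bounded: "integrable ?M f" "integrable M1 (\<lambda>a. f (a, b))"
    if [measurable]: "f \<in> borel_measurable ?M" and le: "\<And>x. f x \<le> c" and f0: "\<And>x. f x > 0"
    for f :: "'a \<times> 'b \<Rightarrow> real" and c :: real and b :: 'b
  proof -
    have norm: "norm (f x) \<le> c" for x using le[of x] f0[of x] by simp
    show "integrable ?M f" by (rule P.integrable_const_bound[of _ c]) (use norm in auto)
    show "integrable M1 (\<lambda>a. f (a, b))"
    proof (rule M1.integrable_const_bound[of _ c])
      show "(\<lambda>a. f (a, b)) \<in> borel_measurable M1"
        using space by (intro measurable_compose[OF measurable_Pair2'[of b M2 M1] that(1)]) auto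
    qed (use norm in auto)
  qed
  show ?thesis
    unfolding prekopa_leindler_def
  proof (intro ballI allI impI, elim conjE)
    fix t :: real and u v w :: "'a \<times> 'b \<Rightarrow> real"
    assume t: "t \<in> {0..1}"
      and int: "integrable ?M u" "integrable ?M v" "integrable ?M w"
      and all_pos: "\<forall>x. u x > 0" "\<forall>x. v x > 0" "\<forall>x. w x > 0"
      and uvw: "\<forall>x y. \<forall>z\<in>intermediate_points t x y.
        u x powr (1 - t) * v y powr t * exp (- K * (t * (1 - t) / 2) * (dist x y)\<^sup>2) \<le> w z"
    have pos: "u x > 0" "v x > 0" "w x > 0" for x
      using all_pos by blast+
    have u [measurable]: "u \<in> borel_measurable ?M" and v [measurable]: "v \<in> borel_measurable ?M"
      and [measurable]: "w \<in> borel_measurable ?M"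
      using int by auto
    define cut where "cut f n x = min (f x) (real (Suc n) * g x)"
      for f :: "'a \<times> 'b \<Rightarrow> real" and n x
    have cut_meas: "cut f n \<in> borel_measurable ?M" if [measurable]: "f \<in> borel_measurable ?M" for f n
      unfolding cut_def by measurable
    have cut_pos: "cut f n x > 0" if "\<And>x. f x > 0" for f n x
      using that[of x] g0[of x] by (simp add: cut_def)
    have cut_le: "cut f n x \<le> f x" "cut f n x \<le> real (Suc n) * g x" for f n x
      by (simp_all add: cut_def)
    have cut_bound: "cut f n x \<le> real (Suc n)" for f n x
      by (rule order_trans[OF cut_le(2) mult_left_le[OF g1]]) simp
    have cut_int: "integrable ?M (cut f n)" "integrable M1 (\<lambda>a. cut f n (a, b))"
      if f: "f \<in> borel_measurable ?M" "\<And>x. f x > 0" for f n b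
      by (rule bounded[OF cut_meas[OF f(1)] cut_bound cut_pos[OF f(2)]])+
    have trunc: "(\<integral>x. cut u n x \<partial>?M) powr (1 - t) * (\<integral>x. cut v n x \<partial>?M) powr t
        \<le> (\<integral>x. w x \<partial>?M)" for n
    proof -
      let ?w = "\<lambda>x. min (w x) (real (Suc n))"
      have w: "?w \<in> borel_measurable ?M" "?w x \<le> real (Suc n)" "?w x > 0" for x
        using pos by simp_all
      have "(\<integral>x. cut u n x \<partial>?M) powr (1 - t) * (\<integral>x. cut v n x \<partial>?M) powr t
          \<le> (\<integral>x. ?w x \<partial>?M)"
      proof (rule prekopa_leindler_pair_sections[OF M1.prob_space_axioms M2.prob_space_axioms
            assms(3,4) t])
        fix x y z :: "'a \<times> 'b" assume z: "z \<in> intermediate_points t x y"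
        let ?e = "exp (- K * (t * (1 - t) / 2) * (dist x y)\<^sup>2)"
        have "cut u n x powr (1 - t) * cut v n y powr t * ?e \<le> u x powr (1 - t) * v y powr t * ?e"
          using t by (intro mult_right_mono mult_mono powr_mono2 cut_le)
            (simp_all add: less_imp_le cut_pos pos)
        also have "\<dots> \<le> w z" using uvw z by blast
        finally have "cut u n x powr (1 - t) * cut v n y powr t * ?e \<le> w z" .
        moreover have "cut u n x powr (1 - t) * cut v n y powr t * ?e \<le> real (Suc n)"
          by (rule powr_weights_exp_le[OF t _ cut_pos[OF pos(1)] cut_pos[OF pos(2)]
                cut_le(2)[unfolded g_def] cut_le(2)[unfolded g_def]]) simp
        ultimately show "cut u n x powr (1 - t) * cut v n y powr t * ?e \<le> ?w z"
          by simp
      next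
        show "integrable ?M (cut u n)" "integrable M1 (\<lambda>a. cut u n (a, b))"
          "integrable ?M (cut v n)" "integrable M1 (\<lambda>a. cut v n (a, b))" for b
          by (intro cut_int[OF u pos(1)] cut_int[OF v pos(2)])+
        show "integrable ?M ?w" "integrable M1 (\<lambda>a. ?w (a, b))" for b
          by (intro bounded[OF w])+
      qed (intro cut_pos pos w(3))+
      also have "\<dots> \<le> (\<integral>x. w x \<partial>?M)"
        using int by (intro integral_mono bounded(1)[OF w]) auto
      finally show ?thesis .
    qed
    have lim: "(\<lambda>n. \<integral>x. cut f n x \<partial>?M) \<longlonglongrightarrow> (\<integral>x. f x \<partial>?M)"
      if "integrable ?M f" "\<And>x. f x > 0" for f
      unfolding cut_def using that g0 by (intro integral_min_mult_tendsto g) auto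
    have "(\<integral>x. u x \<partial>?M) > 0" "(\<integral>x. v x \<partial>?M) > 0"
      using int pos by (auto intro: P.integral_pos)
    then have "(\<lambda>n. (\<integral>x. cut u n x \<partial>?M) powr (1 - t) * (\<integral>x. cut v n x \<partial>?M) powr t)
        \<longlonglongrightarrow> (\<integral>x. u x \<partial>?M) powr (1 - t) * (\<integral>x. v x \<partial>?M) powr t"
      using int pos by (intro tendsto_mult tendsto_powr tendsto_const lim) auto
    then show "(\<integral>x. u x \<partial>?M) powr (1 - t) * (\<integral>x. v x \<partial>?M) powr t \<le> (\<integral>x. w x \<partial>?M)"
      by (rule LIMSEQ_le_const2) (use trunc in blast)
  qed
qed

end
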